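(* Let $\mathscr{D}$ be a class of compact Hausdorff spaces that is preserved when taking closed subspaces and Hausdorff quotients, and which contains no non-metrizable linearly ordered space. Then every $K \in \mathscr{D}$ has the Bishop property.
   Context: For a compact Hausdorff space $K$, $C(K)$ is the Banach space of all scalar-valued (real or complex) continuous functions on $K$ with the supremum norm. For $f\in C(K)$, $\operatorname{supp} f$ is the closure of $\{t\in K: f(t)\neq 0\}$. For distinct $f,g\in C(K)$ write $f\prec g$ if $f$ and $g$ agree on $\operatorname{supp} f$; this is a strict partial order. A subset $F\subseteq C(K)$ is a $\prec$-chain if for all distinct $f,g\in F$ either $f\prec g$ or $g\prec f$. The space $K$ has the Bishop property if $\inf\{\|f-g\| : f,g\in F,\ f\prec g\}=0$ for every norm-bounded uncountable $\prec$-chain $F$ in $C(K)$. (Equivalently: every norm-bounded $\prec$-chain $F\subseteq C(K)$ such that $\|f-g\|\geqslant 1$ for all distinct $f,g\in F$ is at most countable.) A Hausdorff quotient of a compact space $K$ is a Hausdorff space that is the image of $K$ under a continuous surjection (automatically a quotient map). A linearly ordered space is a topological space whose topology is the order topology of some linear order on it. *)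

theory Defs
  imports "HOL-Analysis.Analysis"
begin

text \<open>Elements of \<open>C(K)\<close> are \<open>undefined\<close> outside the carrier, so that equality of two
  elements means equality on \<open>K\<close>.\<close>

definition cont_functions :: "'a topology \<Rightarrow> ('a \<Rightarrow> 'b::real_normed_vector) set" where
  "cont_functions K = {f \<in> extensional (topspace K). continuous_map K euclidean f}"

text \<open>The case distinction is needed since the supremum of the empty set of reals
  is unspecified.\<close>

definition sup_norm :: "'a topology \<Rightarrow> ('a \<Rightarrow> 'b::real_normed_vector) \<Rightarrow> real" where
  "sup_norm K f = (if topspace K = {} then 0 else (SUP t\<in>topspace K. norm (f t)))"

definition supp :: "'a topology \<Rightarrow> ('a \<Rightarrow> 'b::zero) \<Rightarrow> 'a set" where
  "supp K f = K closure_of {t \<in> topspace K. f t \<noteq> 0}"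

definition bishop_less :: "'a topology \<Rightarrow> ('a \<Rightarrow> 'b::zero) \<Rightarrow> ('a \<Rightarrow> 'b) \<Rightarrow> bool" where
  "bishop_less K f g \<longleftrightarrow> f \<noteq> g \<and> (\<forall>t\<in>supp K f. f t = g t)"

definition bishop_chain :: "'a topology \<Rightarrow> ('a \<Rightarrow> 'b::real_normed_vector) set \<Rightarrow> bool" where
  "bishop_chain K F \<longleftrightarrow> F \<subseteq> cont_functions K \<and>
     (\<forall>f\<in>F. \<forall>g\<in>F. f \<noteq> g \<longrightarrow> bishop_less K f g \<or> bishop_less K g f)"

text \<open>The first argument selects the scalar field. The set whose infimum is taken is nonempty
  (as \<open>F\<close> is an uncountable chain) and bounded below by \<open>0\<close>.\<close>

definition bishop_property :: "'b::real_normed_field itself \<Rightarrow> 'a topology \<Rightarrow> bool" where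
  "bishop_property S K \<longleftrightarrow>
     (\<forall>F :: ('a \<Rightarrow> 'b) set.
        bishop_chain K F \<and> uncountable F \<and> (\<exists>B. \<forall>f\<in>F. sup_norm K f \<le> B) \<longrightarrow>
        Inf {sup_norm K (\<lambda>t. f t - g t) | f g. f \<in> F \<and> g \<in> F \<and> bishop_less K f g} = 0)"

text \<open>The whole carrier is added to the subbase of open rays because on a one-point order all
  rays are empty.\<close>

definition order_topology_on :: "'a set \<Rightarrow> 'a rel \<Rightarrow> 'a topology" where
  "order_topology_on A r = topology_generated_by
     (insert A ((\<lambda>a. {x \<in> A. (x, a) \<in> r \<and> x \<noteq> a}) ` A \<union>
                (\<lambda>a. {x \<in> A. (a, x) \<in> r \<and> x \<noteq> a}) ` A))"

definition linearly_ordered_space :: "'a topology \<Rightarrow> bool" where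
  "linearly_ordered_space X \<longleftrightarrow>
     (\<exists>r. linear_order_on (topspace X) r \<and> X = order_topology_on (topspace X) r)"

definition hausdorff_quotient_of :: "'a topology \<Rightarrow> 'b topology \<Rightarrow> bool" where
  "hausdorff_quotient_of Y K \<longleftrightarrow>
     Hausdorff_space Y \<and> (\<exists>q. continuous_map K Y q \<and> q ` topspace K = topspace Y)"

end

theory Submission
  imports Defs
begin

text \<open>If \<open>F\<close> is an uncountable \<open>\<prec>\<close>-chain whose members are pairwise at distance at least \<open>\<delta> > 0\<close>,
  then each \<open>f \<in> F\<close> attains at any given point \<open>t\<close> either \<open>0\<close> or one and the same value \<open>c(t)\<close>.
  On the closed set \<open>C\<close> of all \<open>t\<close> with \<open>f t = 0\<close> or \<open>\<bar>f t\<bar> \<ge> \<delta>/2\<close> for every \<open>f \<in> F\<close>, the sets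
  \<open>{t \<in> C. f t \<noteq> 0}\<close> are clopen, they increase with \<open>f\<close>, and they are pairwise distinct because
  a point where \<open>f\<close> and \<open>g\<close> are far apart lies in \<open>C\<close>. Identifying the points of \<open>C\<close> that
  this uncountable chain of clopen sets does not separate yields a compact linearly ordered
  quotient with uncountably many clopen sets, which is therefore not metrizable.\<close>

section \<open>Order topologies\<close>

lemma topspace_order_topology_on [simp]: "topspace (order_topology_on A r) = A"
  unfolding order_topology_on_def topology_generated_by_topspace by blast

lemma openin_order_topology_on_rays:
  assumes "a \<in> A"
  shows "openin (order_topology_on A r) {x \<in> A. (x, a) \<in> r \<and> x \<noteq> a}"
    and "openin (order_topology_on A r) {x \<in> A. (a, x) \<in> r \<and> x \<noteq> a}"
  unfolding order_topology_on_def using assms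
  by (auto intro!: topology_generated_by_Basis)

text \<open>For x below y, a point strictly between them supplies a lower and an upper ray that
  separate them. If there is none, the ray below y and the ray above x are already disjoint.\<close>

lemma Hausdorff_space_order_topology_on:
  assumes "linear_order_on A r"
  shows "Hausdorff_space (order_topology_on A r)"
proof -
  have tot: "(x, y) \<in> r \<or> (y, x) \<in> r" if "x \<in> A" "y \<in> A" "x \<noteq> y" for x y
    using assms that by (auto simp: linear_order_on_def total_on_def)
  have antisym: "x = y" if "(x, y) \<in> r" "(y, x) \<in> r" for x y
    using assms that by (auto simp: linear_order_on_def partial_order_on_def antisym_def)
  have trans: "(x, z) \<in> r" if "(x, y) \<in> r" "(y, z) \<in> r" for x y z
    using assms that
    by (auto simp: linear_order_on_def partial_order_on_def preorder_on_def dest: transD)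
  let ?X = "order_topology_on A r"
  let ?lo = "\<lambda>a. {x \<in> A. (x, a) \<in> r \<and> x \<noteq> a}"
  let ?hi = "\<lambda>a. {x \<in> A. (a, x) \<in> r \<and> x \<noteq> a}"
  have sep: "\<exists>U V. openin ?X U \<and> openin ?X V \<and> x \<in> U \<and> y \<in> V \<and> disjnt U V"
    if xy: "x \<in> A" "y \<in> A" "(x, y) \<in> r" "x \<noteq> y" for x y
  proof (cases "\<exists>z. z \<in> ?hi x \<inter> ?lo y")
    case True
    then obtain z where z: "z \<in> ?hi x \<inter> ?lo y" by blast
    have "x \<in> ?lo z" "y \<in> ?hi z" "disjnt (?lo z) (?hi z)"
      using z xy antisym by (auto simp: disjnt_def)
    then show ?thesis
      using openin_order_topology_on_rays[of z A r] z by blast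
  next
    case False
    have "disjnt (?lo y) (?hi x)"
      using False by (auto simp: disjnt_def)
    then show ?thesis
      using openin_order_topology_on_rays[of _ A r] xy by blast
  qed
  have "\<exists>U V. openin ?X U \<and> openin ?X V \<and> x \<in> U \<and> y \<in> V \<and> disjnt U V"
    if xy: "x \<in> A" "y \<in> A" "x \<noteq> y" for x y
    using tot[OF xy] sep[of x y] sep[of y x] xy by (metis disjnt_sym)
  then show ?thesis
    unfolding Hausdorff_space_def by simp
qed

section \<open>Clopen sets in compact spaces\<close>

text \<open>Total boundedness provides a countable base of balls \<open>\<B>\<close>. A clopen set
  is compact, hence a finite union of members of \<open>\<B>\<close>, and a countable family has
  only countably many finite subfamilies.\<close>

lemma countable_clopen_if_compact_metrizable:
  assumes "compact_space X" "metrizable_space X"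
  shows "countable {U. openin X U \<and> closedin X U}"
proof -
  obtain M d where "Metric_space M d" and X: "X = Metric_space.mtopology M d"
    using assms(2) by (auto simp: metrizable_space_def)
  then interpret Metric_space M d by simp
  have "mtotally_bounded M"
    using assms(1) compact_space_eq_mcomplete_mtotally_bounded X by blast
  then have "\<forall>n. \<exists>S. finite S \<and> S \<subseteq> M \<and> M \<subseteq> (\<Union>x\<in>S. mball x (inverse (Suc n)))"
    by (simp add: mtotally_bounded_def)
  then obtain S where S: "\<And>n. finite (S n)" "\<And>n. S n \<subseteq> M"
      "\<And>n. M \<subseteq> (\<Union>x\<in>S n. mball x (inverse (Suc n)))"
    by metis
  define \<B> where "\<B> = (\<Union>n. (\<lambda>x. mball x (inverse (Suc n))) ` S n)"
  have "countable \<B>"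
    unfolding \<B>_def using S(1) by (intro countable_UN) (auto intro: countable_finite)
  have "U \<in> \<Union> ` {\<F>. finite \<F> \<and> \<F> \<subseteq> \<B>}" if U: "openin X U" "closedin X U" for U
  proof -
    have cover: "\<exists>B\<in>\<B>. x \<in> B \<and> B \<subseteq> U" if "x \<in> U" for x
    proof -
      obtain r where r: "r > 0" "mball x r \<subseteq> U"
        using U(1) \<open>x \<in> U\<close> unfolding X openin_mtopology by blast
      have "x \<in> M"
        using U(1) \<open>x \<in> U\<close> unfolding X openin_mtopology by blast
      \<comment> \<open>Both the distance from x to the net point y and the radius around y are then
        below r/2, so the ball around y stays within distance r of x.\<close>
      obtain n where n: "inverse (Suc n) < r / 2"
        using reals_Archimedean[of "r/2"] r by auto
      obtain y where y: "y \<in> S n" "x \<in> mball y (inverse (Suc n))"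
        using S(3)[of n] \<open>x \<in> M\<close> by blast
      have "mball y (inverse (Suc n)) \<subseteq> mball x r"
        using y n by (intro mball_subset) (auto simp: commute)
      then show ?thesis
        using y r unfolding \<B>_def by blast
    qed
    have "compactin X U"
      using assms(1) U(2) by (rule closedin_compact_space)
    moreover have "\<forall>B\<in>{B \<in> \<B>. B \<subseteq> U}. openin X B"
      unfolding X \<B>_def by auto
    moreover have "U \<subseteq> \<Union>{B \<in> \<B>. B \<subseteq> U}"
      using cover by blast
    ultimately obtain \<F> where "finite \<F>" "\<F> \<subseteq> {B \<in> \<B>. B \<subseteq> U}" "U \<subseteq> \<Union>\<F>"
      unfolding compactin_def by meson
    then have "U = \<Union>\<F>" "\<F> \<subseteq> \<B>" by auto
    then show ?thesis
      using \<open>finite \<F>\<close> by blast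
  qed
  then have "{U. openin X U \<and> closedin X U} \<subseteq> \<Union> ` {\<F>. finite \<F> \<and> \<F> \<subseteq> \<B>}"
    by blast
  moreover have "countable (\<Union> ` {\<F>. finite \<F> \<and> \<F> \<subseteq> \<B>})"
    using \<open>countable \<B>\<close> by (intro countable_image countable_Collect_finite_subset)
  ultimately show ?thesis
    by (rule countable_subset)
qed

text \<open>The points of the quotient are chosen representatives of the equivalence classes, so that the
  quotient is again a topology on the type of \<open>L\<close>.\<close>

lemma nonmetrizable_linearly_ordered_quotient:
  fixes L :: "'a topology"
  assumes "compact_space L" and "uncountable \<V>"
    and clopen: "\<And>V. V \<in> \<V> \<Longrightarrow> openin L V \<and> closedin L V"
    and nested: "\<And>V W. V \<in> \<V> \<Longrightarrow> W \<in> \<V> \<Longrightarrow> V \<subseteq> W \<or> W \<subseteq> V"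
  obtains Y :: "'a topology" where "hausdorff_quotient_of Y L" "linearly_ordered_space Y" "\<not> metrizable_space Y"
proof -
  have sub: "V \<subseteq> topspace L" if "V \<in> \<V>" for V
    using clopen[OF that] openin_subset by blast
  \<comment> \<open>The predicate under \<open>SOME\<close> depends on x only through the members of
    \<open>\<V>\<close> that contain x, so points not separated by \<open>\<V>\<close> receive the
    same representative.\<close>
  define s where "s x = (SOME y. y \<in> topspace L \<and> (\<forall>V\<in>\<V>. y \<in> V \<longleftrightarrow> x \<in> V))" for x
  have s: "s x \<in> topspace L \<and> (\<forall>V\<in>\<V>. s x \<in> V \<longleftrightarrow> x \<in> V)" if "x \<in> topspace L" for x
    unfolding s_def by (rule someI[of _ x]) (use that in blast)
  have s_eq: "s x = s y" if "\<forall>V\<in>\<V>. x \<in> V \<longleftrightarrow> y \<in> V" for x y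
    unfolding s_def using that by (metis (no_types, lifting))
  define A where "A = s ` topspace L"
  have A_sub: "A \<subseteq> topspace L"
    using s by (auto simp: A_def)
  have A_eq: "x = y" if xy: "x \<in> A" "y \<in> A" "\<forall>V\<in>\<V>. x \<in> V \<longleftrightarrow> y \<in> V" for x y
  proof -
    obtain x' y' where x': "x' \<in> topspace L" "x = s x'" and y': "y' \<in> topspace L" "y = s y'"
      using xy by (auto simp: A_def)
    then have "\<forall>V\<in>\<V>. x' \<in> V \<longleftrightarrow> y' \<in> V"
      using xy s by auto
    then show ?thesis
      using s_eq x' y' by simp
  qed
  \<comment> \<open>Members of \<open>\<V>\<close> become upper sets. Nestedness of
    \<open>\<V>\<close> gives totality; antisymmetry holds because A contains one point per
    class.\<close>
  define r where "r = {(x, y). x \<in> A \<and> y \<in> A \<and> (\<forall>V\<in>\<V>. x \<in> V \<longrightarrow> y \<in> V)}"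
  have nested_points: "(\<forall>V\<in>\<V>. x \<in> V \<longrightarrow> y \<in> V) \<or> (\<forall>W\<in>\<V>. y \<in> W \<longrightarrow> x \<in> W)" for x y
  proof (rule ccontr)
    assume "\<not> ?thesis"
    then obtain V W where "V \<in> \<V>" "x \<in> V" "y \<notin> V" "W \<in> \<V>" "y \<in> W" "x \<notin> W"
      by blast
    then show False
      using nested[of V W] by blast
  qed
  have lin: "linear_order_on A r"
    unfolding linear_order_on_def partial_order_on_def preorder_on_def
  proof (intro conjI)
    show "r \<subseteq> A \<times> A" "refl_on A r" "trans r"
      by (auto simp: r_def refl_on_def trans_def)
    show "antisym r"
      using A_eq by (auto simp: r_def antisym_def)
    show "total_on A r"
      using nested_points by (auto simp: total_on_def r_def)
  qed
  \<comment> \<open>A strict inequality is witnessed by a single member of \<open>\<V>\<close>; this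
    turns preimages of rays into unions of clopen sets.\<close>
  have lower: "(x, a) \<in> r \<and> x \<noteq> a \<longleftrightarrow> (\<exists>V\<in>\<V>. a \<in> V \<and> x \<notin> V)" if xa: "x \<in> A" "a \<in> A" for x a
  proof
    assume "(x, a) \<in> r \<and> x \<noteq> a"
    then show "\<exists>V\<in>\<V>. a \<in> V \<and> x \<notin> V"
      using A_eq[OF xa] by (auto simp: r_def)
  next
    assume "\<exists>V\<in>\<V>. a \<in> V \<and> x \<notin> V"
    then show "(x, a) \<in> r \<and> x \<noteq> a"
      using nested_points[of x a] xa by (auto simp: r_def)
  qed
  have s_A: "s x \<in> A" if "x \<in> topspace L" for x
    using that by (simp add: A_def)
  have lower_s: "(s x, a) \<in> r \<and> s x \<noteq> a \<longleftrightarrow> (\<exists>V\<in>\<V>. a \<in> V \<and> x \<notin> V)"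
    and upper_s: "(a, s x) \<in> r \<and> s x \<noteq> a \<longleftrightarrow> (\<exists>V\<in>\<V>. x \<in> V \<and> a \<notin> V)"
    if "x \<in> topspace L" "a \<in> A" for x a
    using lower[OF s_A[OF that(1)] that(2)] lower[OF that(2) s_A[OF that(1)]] s[OF that(1)]
    by metis+
  define Y where "Y = order_topology_on A r"
  have "Hausdorff_space Y"
    unfolding Y_def using lin by (rule Hausdorff_space_order_topology_on)
  have cont: "continuous_map L Y s"
    unfolding Y_def order_topology_on_def
  proof (intro continuous_on_generated_topo)
    fix U assume "U \<in> insert A ((\<lambda>a. {x \<in> A. (x, a) \<in> r \<and> x \<noteq> a}) ` A \<union>
                (\<lambda>a. {x \<in> A. (a, x) \<in> r \<and> x \<noteq> a}) ` A)"
    then consider "U = A" | a where "a \<in> A" "U = {x \<in> A. (x, a) \<in> r \<and> x \<noteq> a}"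
      | a where "a \<in> A" "U = {x \<in> A. (a, x) \<in> r \<and> x \<noteq> a}"
      by blast
    then show "openin L (s -` U \<inter> topspace L)"
    proof cases
      case 1
      then have "s -` U \<inter> topspace L = topspace L"
        by (auto simp: A_def)
      then show ?thesis by simp
    next
      case (2 a)
      \<comment> \<open>For lower rays closedness of the members of \<open>\<V>\<close> is used, for
        upper rays their openness.\<close>
      have "s -` U \<inter> topspace L = \<Union>((\<lambda>V. topspace L - V) ` {V \<in> \<V>. a \<in> V})"
        unfolding 2 using lower_s[OF _ \<open>a \<in> A\<close>] s_A by auto
      moreover have "openin L (\<Union>((\<lambda>V. topspace L - V) ` {V \<in> \<V>. a \<in> V}))"
        using clopen by (intro openin_Union) blast
      ultimately show ?thesis by (simp only:)
    next
      case (3 a)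
      have "s -` U \<inter> topspace L = \<Union>{V \<in> \<V>. a \<notin> V}"
      proof -
        have "s -` U \<inter> topspace L = {x \<in> topspace L. (a, s x) \<in> r \<and> s x \<noteq> a}"
          unfolding 3 using s_A by auto
        also have "\<dots> = {x \<in> topspace L. \<exists>V\<in>\<V>. x \<in> V \<and> a \<notin> V}"
          using upper_s[OF _ \<open>a \<in> A\<close>] by (intro Collect_cong conj_cong refl)
        also have "\<dots> = \<Union>{V \<in> \<V>. a \<notin> V}"
          using sub by auto
        finally show ?thesis .
      qed
      then show ?thesis
        using clopen by (auto intro!: openin_Union)
    qed
  qed (auto simp: A_def)
  have quot: "hausdorff_quotient_of Y L"
    unfolding hausdorff_quotient_of_def
    using \<open>Hausdorff_space Y\<close> cont by (auto simp: A_def Y_def)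
  have "compact_space Y"
    using image_compactin[OF _ cont, of "topspace L"] \<open>compact_space L\<close>
    by (simp add: compact_space_def Y_def A_def)
  have "closed_map L Y s"
    using \<open>compact_space L\<close> \<open>Hausdorff_space Y\<close> cont
    by (intro continuous_imp_closed_map_gen Hausdorff_imp_kc_space)
  \<comment> \<open>Each V is saturated for s, so s maps the complement of V onto the complement of
    the image. As s is a closed map, the image of V is both closed and open.\<close>
  have clopen_Y: "openin Y (s ` V) \<and> closedin Y (s ` V)" if "V \<in> \<V>" for V
  proof
    show "closedin Y (s ` V)"
      using \<open>closed_map L Y s\<close> clopen[OF that] by (simp add: closed_map_def)
    have "closedin Y (s ` (topspace L - V))"
      using \<open>closed_map L Y s\<close> clopen[OF that] by (simp add: closed_map_def closedin_diff)
    moreover have "s ` (topspace L - V) = topspace Y - s ` V"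
    proof -
      have "s x \<noteq> s y" if "x \<in> topspace L" "y \<in> topspace L" "x \<notin> V" "y \<in> V" for x y
        using s[of x] s[of y] that \<open>V \<in> \<V>\<close> by metis
      then show ?thesis
        using sub[OF that] by (fastforce simp: Y_def A_def)
    qed
    moreover have "s ` V \<subseteq> topspace Y"
      using \<open>closedin Y (s ` V)\<close> closedin_subset by blast
    ultimately show "openin Y (s ` V)"
      by (simp add: openin_closedin_eq)
  qed
  have "inj_on ((`) s) \<V>"
  proof (rule inj_onI)
    fix V W assume VW: "V \<in> \<V>" "W \<in> \<V>" "s ` V = s ` W"
    \<comment> \<open>By saturation V is recovered as the preimage of its image, so no two members
      of \<open>\<V>\<close> are merged in the quotient.\<close>
    have eq: "{x \<in> topspace L. s x \<in> s ` V} = V" if "V \<in> \<V>" for V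
    proof
      show "V \<subseteq> {x \<in> topspace L. s x \<in> s ` V}"
        using sub[OF that] by blast
      show "{x \<in> topspace L. s x \<in> s ` V} \<subseteq> V"
      proof
        fix x assume "x \<in> {x \<in> topspace L. s x \<in> s ` V}"
        then obtain y where "x \<in> topspace L" "y \<in> V" "s x = s y" by blast
        then show "x \<in> V"
          using s[of x] s[of y] sub[OF that] that by auto
      qed
    qed
    show "V = W"
      using eq[OF VW(1)] unfolding VW(3) eq[OF VW(2)] by (rule sym)
  qed
  then have "uncountable ((`) s ` \<V>)"
    using \<open>uncountable \<V>\<close> countable_image_inj_eq by blast
  moreover have "(`) s ` \<V> \<subseteq> {U. openin Y U \<and> closedin Y U}"
    using clopen_Y by blast
  ultimately have "\<not> metrizable_space Y"
    using countable_clopen_if_compact_metrizable[OF \<open>compact_space Y\<close>] countable_subset by blast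
  moreover have "linearly_ordered_space Y"
    unfolding linearly_ordered_space_def using lin by (auto simp: Y_def)
  ultimately show ?thesis
    using quot that by blast
qed

section \<open>Separated chains of continuous functions\<close>

lemma bishop_lessD:
  assumes "bishop_less K f g" "t \<in> topspace K" "f t \<noteq> 0"
  shows "g t = f t"
proof -
  have "{t \<in> topspace K. f t \<noteq> 0} \<subseteq> supp K f"
    unfolding supp_def by (intro closure_of_subset) blast
  then show ?thesis
    using assms unfolding bishop_less_def by fastforce
qed

text \<open>Suprema of reals behave well only for bounded sets; compactness of K supplies the bound
  whenever \<open>sup_norm\<close> of a difference is estimated.\<close>

lemma bdd_above_norm_diff:
  fixes f g :: "'a \<Rightarrow> 'b::real_normed_vector"
  assumes "compact_space K" "f \<in> cont_functions K" "g \<in> cont_functions K"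
  shows "bdd_above ((\<lambda>t. norm (f t - g t)) ` topspace K)"
proof -
  have "continuous_map K euclidean (\<lambda>t. norm (f t - g t))"
    using assms(2,3) unfolding cont_functions_def
    by (intro continuous_map_norm continuous_map_diff) auto
  then have "compactin euclidean ((\<lambda>t. norm (f t - g t)) ` topspace K)"
    using assms(1) image_compactin unfolding compact_space_def by blast
  then show ?thesis
    by (simp add: compact_imp_bounded bounded_imp_bdd_above)
qed

lemma sup_norm_diff_nonneg:
  fixes f g :: "'a \<Rightarrow> 'b::real_normed_vector"
  assumes "compact_space K" "f \<in> cont_functions K" "g \<in> cont_functions K"
  shows "0 \<le> sup_norm K (\<lambda>t. f t - g t)"
proof (cases "topspace K = {}")
  case False
  then obtain t where t: "t \<in> topspace K" by blast
  have "0 \<le> (SUP t\<in>topspace K. norm (f t - g t))"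
    by (rule cSUP_upper2[OF bdd_above_norm_diff[OF assms] t norm_ge_zero])
  then show ?thesis
    using False by (simp add: sup_norm_def)
qed (simp add: sup_norm_def)

lemma nested_clopen_sets_of_separated_chain:
  fixes F :: "('a \<Rightarrow> 'b::real_normed_vector) set"
  assumes "compact_space K" "bishop_chain K F" "uncountable F" "\<delta> > 0"
    and far: "\<And>f g. f \<in> F \<Longrightarrow> g \<in> F \<Longrightarrow> bishop_less K f g \<Longrightarrow> \<delta> \<le> sup_norm K (\<lambda>t. f t - g t)"
  obtains C \<V> where "closedin K C" "uncountable \<V>"
    "\<And>V. V \<in> \<V> \<Longrightarrow> openin (subtopology K C) V \<and> closedin (subtopology K C) V"
    "\<And>V W. V \<in> \<V> \<Longrightarrow> W \<in> \<V> \<Longrightarrow> V \<subseteq> W \<or> W \<subseteq> V"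
proof -
  have F_cont: "f \<in> cont_functions K" "continuous_map K euclidean f" if "f \<in> F" for f
    using assms(2) that by (auto simp: bishop_chain_def cont_functions_def)
  have cmp: "f = g \<or> bishop_less K f g \<or> bishop_less K g f" if "f \<in> F" "g \<in> F" for f g
    using assms(2) that by (auto simp: bishop_chain_def)
  \<comment> \<open>The allowed values form a closed set in which 0 is isolated. On C the conditions
    \<open>f t \<noteq> 0\<close> (open) and \<open>norm (f t) \<ge> \<delta>/2\<close> (closed)
    therefore coincide, which makes \<open>V f\<close> clopen.\<close>
  define C where "C = {t \<in> topspace K. \<forall>f\<in>F. f t \<in> - ball 0 (\<delta>/2) \<union> {0}}"
  define V where "V f = {t \<in> topspace (subtopology K C). f t \<in> - {0}}" for f :: "'a \<Rightarrow> 'b"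
  have pre: "closedin K {t \<in> topspace K. f t \<in> S}" if "f \<in> F" "closed S" for f S
    using closedin_continuous_map_preimage[OF F_cont(2)[OF that(1)], of S] that(2) by simp
  \<comment> \<open>Over an empty index set the intersection below would be \<open>UNIV\<close>
    instead of the carrier.\<close>
  have F_ne: "F \<noteq> {}"
    using \<open>uncountable F\<close> by auto
  have "closedin K C"
  proof -
    have "C = (\<Inter>f\<in>F. {t \<in> topspace K. f t \<in> - ball 0 (\<delta>/2) \<union> {0}})"
      using F_ne by (auto simp: C_def)
    moreover have "closedin K (\<Inter>f\<in>F. {t \<in> topspace K. f t \<in> - ball 0 (\<delta>/2) \<union> {0}})"
      using F_ne by (intro closedin_INT pre closed_Un closed_Compl open_ball closed_singleton)
    ultimately show ?thesis by simp
  qed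
  have C_sub: "C \<subseteq> topspace K"
    by (auto simp: C_def)
  have V_clopen: "openin (subtopology K C) (V f) \<and> closedin (subtopology K C) (V f)"
    if "f \<in> F" for f
  proof
    have cont: "continuous_map (subtopology K C) euclidean f"
      using F_cont(2)[OF that] by (rule continuous_map_from_subtopology)
    show "openin (subtopology K C) (V f)"
      unfolding V_def by (rule openin_continuous_map_preimage[OF cont]) auto
    have "V f = {t \<in> topspace (subtopology K C). f t \<in> - ball 0 (\<delta>/2)}"
      using that \<open>\<delta> > 0\<close> C_sub by (auto simp: V_def C_def)
    then show "closedin (subtopology K C) (V f)"
      using closedin_continuous_map_preimage[OF cont, of "- ball 0 (\<delta>/2)"]
      by (simp add: closed_Compl)
  qed
  have V_mono: "V f \<subseteq> V g" if "bishop_less K f g" for f g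
    using bishop_lessD[OF that] by (auto simp: V_def)
  have V_neq: "V f \<noteq> V g" if fg: "f \<in> F" "g \<in> F" and less: "bishop_less K f g" for f g
  proof -
    \<comment> \<open>This selects the supremum branch of \<open>sup_norm\<close>. On an empty
      carrier all extensional functions coincide.\<close>
    have "topspace K \<noteq> {}"
    proof
      assume "topspace K = {}"
      then have "f = g"
        using F_cont(1)[OF fg(1)] F_cont(1)[OF fg(2)]
        by (auto simp: cont_functions_def extensional_def)
      then show False
        using less by (simp add: bishop_less_def)
    qed
    \<comment> \<open>Halving makes the inequality strict, so some point exceeds the bound without
      an appeal to attainment of the supremum.\<close>
    moreover have "\<delta>/2 < sup_norm K (\<lambda>t. f t - g t)"
      using far[OF fg less] \<open>\<delta> > 0\<close> by linarith
    ultimately have "\<exists>t\<in>topspace K. \<delta>/2 < norm (f t - g t)"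
      unfolding sup_norm_def
      using less_cSUP_iff[OF _ bdd_above_norm_diff[OF assms(1) fg[THEN F_cont(1)]]]
      by (simp only: if_False not_False_eq_True simp_thms)
    then obtain t where t: "t \<in> topspace K" "\<delta>/2 < norm (f t - g t)"
      by blast
    have ft: "f t = 0"
    proof (rule ccontr)
      assume "f t \<noteq> 0"
      then have "g t = f t"
        using bishop_lessD[OF less t(1)] by simp
      then show False
        using t(2) \<open>\<delta> > 0\<close> by simp
    qed
    then have gt: "\<delta>/2 < norm (g t)"
      using t(2) by simp
    then have "g t \<noteq> 0"
      using \<open>\<delta> > 0\<close> by auto
    \<comment> \<open>Whichever of g and h is the smaller, if it is nonzero at t then the other
      agrees with it there. As g t is nonzero and large, every member of F has an allowed value at
      t.\<close>
    have "h t = 0 \<or> h t = g t" if "h \<in> F" for h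
      using cmp[OF that \<open>g \<in> F\<close>] bishop_lessD[of K h g t] bishop_lessD[of K g h t] t(1) \<open>g t \<noteq> 0\<close>
      by metis
    then have "t \<in> C"
      using t(1) gt unfolding C_def by fastforce
    then have "t \<in> V g" "t \<notin> V f"
      using t(1) ft \<open>g t \<noteq> 0\<close> by (auto simp: V_def)
    then show ?thesis by blast
  qed
  have "inj_on V F"
    using cmp V_neq by (metis inj_onI)
  then have "uncountable (V ` F)"
    using \<open>uncountable F\<close> countable_image_inj_eq by blast
  with \<open>closedin K C\<close> show ?thesis
  proof (rule that)
    show "openin (subtopology K C) X \<and> closedin (subtopology K C) X" if "X \<in> V ` F" for X
      using that V_clopen by auto
    show "X \<subseteq> Z \<or> Z \<subseteq> X" if "X \<in> V ` F" "Z \<in> V ` F" for X Z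
      using that cmp V_mono by (metis imageE order_refl)
  qed
qed

text \<open>The constant \<open>\<delta>\<close> is the infimum itself, which is positive because it
  is nonzero and all distances are nonnegative. An uncountable chain has two comparable members, so
  the infimum is not over an empty set.\<close>

lemma separated_chain_if_not_bishop_property:
  fixes S :: "'b::real_normed_field itself" and K :: "'a topology"
  assumes "compact_space K" "\<not> bishop_property S K"
  obtains F :: "('a \<Rightarrow> 'b) set" and \<delta> where "bishop_chain K F" "uncountable F" "\<delta> > 0"
    "\<And>f g. f \<in> F \<Longrightarrow> g \<in> F \<Longrightarrow> bishop_less K f g \<Longrightarrow> \<delta> \<le> sup_norm K (\<lambda>t. f t - g t)"
proof -
  obtain F :: "('a \<Rightarrow> 'b) set" where F: "bishop_chain K F" "uncountable F"
    and Inf: "Inf {sup_norm K (\<lambda>t. f t - g t) | f g. f \<in> F \<and> g \<in> F \<and> bishop_less K f g} \<noteq> 0"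
    using assms(2) unfolding bishop_property_def by blast
  define D where "D = {sup_norm K (\<lambda>t. f t - g t) | f g. f \<in> F \<and> g \<in> F \<and> bishop_less K f g}"
  have nonneg: "0 \<le> x" if "x \<in> D" for x
    using that sup_norm_diff_nonneg[OF assms(1)] F(1) by (auto simp: D_def bishop_chain_def)
  obtain f where f: "f \<in> F"
    using F(2) by fastforce
  have "F \<noteq> {f}"
    using F(2) by auto
  then obtain g where g: "g \<in> F" "f \<noteq> g"
    using f by blast
  have "D \<noteq> {}"
    using f g F(1) unfolding D_def bishop_chain_def by blast
  then have "Inf D \<ge> 0"
    using nonneg by (rule cInf_greatest)
  then have "Inf D > 0"
    using Inf by (simp add: D_def)
  moreover have "Inf D \<le> sup_norm K (\<lambda>t. f t - g t)"
    if "f \<in> F" "g \<in> F" "bishop_less K f g" for f g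
    using that nonneg by (intro cInf_lower bdd_belowI[of _ 0]) (auto simp: D_def)
  ultimately show ?thesis
    using that F by blast
qed

text \<open>The scalar field is left generic so that the real and complex cases follow together.
  Only quotients Y on the type of K matter, since the quotient built from a bad chain lives on
  chosen representatives.\<close>

lemma bishop_property_if_linear_quotients_metrizable:
  fixes S :: "'b::real_normed_field itself" and K :: "'a topology"
  assumes "compact_space K"
    and metrizable: "\<And>C (Y :: 'a topology). closedin K C \<Longrightarrow>
      hausdorff_quotient_of Y (subtopology K C) \<Longrightarrow> linearly_ordered_space Y \<Longrightarrow> metrizable_space Y"
  shows "bishop_property S K"
proof (rule ccontr)
  assume non: "\<not> bishop_property S K"
  obtain F :: "('a \<Rightarrow> 'b) set" and \<delta> where F: "bishop_chain K F" "uncountable F" "\<delta> > 0"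
    "\<And>f g. f \<in> F \<Longrightarrow> g \<in> F \<Longrightarrow> bishop_less K f g \<Longrightarrow> \<delta> \<le> sup_norm K (\<lambda>t. f t - g t)"
    using separated_chain_if_not_bishop_property[OF assms(1) non] by blast
  obtain C \<V> where C: "closedin K C" "uncountable \<V>"
    "\<And>V. V \<in> \<V> \<Longrightarrow> openin (subtopology K C) V \<and> closedin (subtopology K C) V"
    "\<And>V W. V \<in> \<V> \<Longrightarrow> W \<in> \<V> \<Longrightarrow> V \<subseteq> W \<or> W \<subseteq> V"
    using nested_clopen_sets_of_separated_chain[OF assms(1) F] by blast
  have "compact_space (subtopology K C)"
    using assms(1) C(1) by (simp add: closedin_compact_space compact_space_subtopology)
  then obtain Y :: "'a topology" where "hausdorff_quotient_of Y (subtopology K C)"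
    "linearly_ordered_space Y" "\<not> metrizable_space Y"
    using C(2-4) by (rule nonmetrizable_linearly_ordered_quotient)
  with metrizable[OF C(1)] show False
    by blast
qed

theorem theorem1p3:
  fixes \<D> :: "'a topology set"
  assumes compact_Hausdorff: "\<And>K. K \<in> \<D> \<Longrightarrow> compact_space K \<and> Hausdorff_space K"
    and closed_subspaces: "\<And>K C. K \<in> \<D> \<Longrightarrow> closedin K C \<Longrightarrow> subtopology K C \<in> \<D>"
    and Hausdorff_quotients: "\<And>K Y. K \<in> \<D> \<Longrightarrow> hausdorff_quotient_of Y K \<Longrightarrow> Y \<in> \<D>"
    and no_nonmetrizable_linear:
      "\<not> (\<exists>L\<in>\<D>. linearly_ordered_space L \<and> \<not> metrizable_space L)"
  shows "\<forall>K\<in>\<D>. bishop_property TYPE(real) K \<and> bishop_property TYPE(complex) K"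
proof
  fix K assume K: "K \<in> \<D>"
  have "compact_space K"
    using compact_Hausdorff[OF K] ..
  \<comment> \<open>The two closure properties, applied in succession, place Y in
    \<open>\<D>\<close>.\<close>
  moreover have "metrizable_space Y"
    if "closedin K C" "hausdorff_quotient_of Y (subtopology K C)" "linearly_ordered_space Y"
    for C and Y :: "'a topology"
    using Hausdorff_quotients[OF closed_subspaces[OF K that(1)] that(2)] that(3)
      no_nonmetrizable_linear by blast
  ultimately show "bishop_property TYPE(real) K \<and> bishop_property TYPE(complex) K"
    by (intro conjI bishop_property_if_linear_quotients_metrizable)
qed

end
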